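(* Let $q$ be an odd prime power with $q\equiv 0,\pm1\pmod 5$, let $b\in\mathbb{F}_q$ with $b^2+b=1$, and let $g(x)=x^q+x^{q^3}+bx^{q^5}$. The maximum scattered $\mathbb{F}_q$-linear set $L_g$ of $\mathrm{PG}(1,q^6)$ is not $\mathrm{P\Gamma L}(2,q^6)$-equivalent to any of the linear sets $L^{1,6}_s$, $L^{2,6}_{t,\rho}$, $L^{3,6}_{h,\xi}$.
   Context: For an $\mathbb{F}_q$-subspace $U$ of $\mathbb{F}_{q^6}^2$, $L_U=\{\langle u\rangle_{\mathbb{F}_{q^6}} : u\in U\setminus\{0\}\}\subseteq\mathrm{PG}(1,q^6)$, and $L_g=L_{U_g}$ with $U_g=\{(x,g(x)) : x\in\mathbb{F}_{q^6}\}$. $L^{1,6}_s$, $L^{2,6}_{t,\rho}$, $L^{3,6}_{h,\xi}$ are the linear sets defined respectively by $U^{1,6}_s=\{(x,x^{q^s})\}$ with $\gcd(s,6)=1$; $U^{2,6}_{t,\rho}=\{(x,\rho x^{q^t}+x^{q^{6-t}})\}$ with $\gcd(t,6)=1$ and $\mathrm{N}_{q^6/q}(\rho)\notin\{0,1\}$; $U^{3,6}_{h,\xi}=\{(x,\xi x^{q^h}+x^{q^{h+3}})\}$ with $\gcd(h,3)=1$, $\mathrm{N}_{q^6/q^3}(\xi)\notin\{0,1\}$ and $\xi,q$ satisfying the additional conditions under which it is maximum scattered (its linear set has $(q^6-1)/(q-1)$ points); here $x$ ranges over $\mathbb{F}_{q^6}$. Linear sets $L,L'$ are $\mathrm{P\Gamma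 L}(2,q^6)$-equivalent if $L^\phi=L'$ for some $\phi\in\mathrm{P\Gamma L}(2,q^6)$. *)

theory Defs
  imports "HOL-Analysis.Cartesian_Space" "HOL-Number_Theory.Number_Theory"
    "HOL-Number_Theory.Prime_Powers"
begin

text \<open>
  Throughout, the type \<open>'a\<close> plays the role of \<open>GF(q^6)\<close>: a finite field with
  \<open>CARD('a) = q ^ 6\<close>. Its unique subfield of order \<open>q\<close> is the fixed field of \<open>x \<mapsto> x ^ q\<close>.
\<close>

definition Fq :: "nat \<Rightarrow> 'a::field set" where
  "Fq q = {x. x ^ q = x}"

text \<open>The norm from \<open>GF(q^m)\<close> to \<open>GF(q)\<close>, as the product of the conjugates.\<close>

definition rel_norm :: "nat \<Rightarrow> nat \<Rightarrow> 'a::field \<Rightarrow> 'a" where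
  "rel_norm q m x = (\<Prod>i<m. x ^ (q ^ i))"

definition PG1_points :: "('a::field ^ 2) set set" where
  "PG1_points = {vec.span {v} | v. v \<noteq> 0}"

definition linear_set :: "('a::field ^ 2) set \<Rightarrow> ('a ^ 2) set set" where
  "linear_set U = (\<lambda>u. vec.span {u}) ` (U - {0})"

definition graph_of :: "('a::field \<Rightarrow> 'a) \<Rightarrow> ('a ^ 2) set" where
  "graph_of f = {vector [x, f x] | x. True}"

definition field_automorphism :: "('a::field \<Rightarrow> 'a) \<Rightarrow> bool" where
  "field_automorphism \<sigma> \<longleftrightarrow> bij \<sigma> \<and> \<sigma> 1 = 1 \<and>
     (\<forall>x y. \<sigma> (x + y) = \<sigma> x + \<sigma> y) \<and> (\<forall>x y. \<sigma> (x * y) = \<sigma> x * \<sigma> y)"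

definition semilinear_map :: "'a::field ^ 2 ^ 2 \<Rightarrow> ('a \<Rightarrow> 'a) \<Rightarrow> 'a ^ 2 \<Rightarrow> 'a ^ 2" where
  "semilinear_map A \<sigma> v = A *v (\<chi> i. \<sigma> (v $ i))"

text \<open>
  The group P\<open>\<Gamma>\<close>L as a set of permutations of the points; \<open>restrict\<close> discards the irrelevant
  values outside the point set, so that scalar multiples of \<open>A\<close> give the same element.
\<close>

definition PGammaL :: "(('a::field ^ 2) set \<Rightarrow> ('a ^ 2) set) set" where
  "PGammaL = {restrict (image (semilinear_map A \<sigma>)) PG1_points | A \<sigma>.
     invertible A \<and> field_automorphism \<sigma>}"

definition PGammaL_equivalent :: "('a::field ^ 2) set set \<Rightarrow> ('a ^ 2) set set \<Rightarrow> bool" where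
  "PGammaL_equivalent L L' \<longleftrightarrow> (\<exists>\<phi>\<in>PGammaL. \<phi> ` L = L')"

text \<open>
  For \<open>U\<close> of dimension 6 over \<open>GF(q)\<close>, being maximum scattered means that the linear set of \<open>U\<close>
  has the largest possible number of points, that is \<open>(q^6 - 1)/(q - 1)\<close>.
\<close>

definition maximum_scattered :: "nat \<Rightarrow> ('a::field ^ 2) set set \<Rightarrow> bool" where
  "maximum_scattered q L \<longleftrightarrow> card L = (q ^ 6 - 1) div (q - 1)"

definition L1 :: "nat \<Rightarrow> nat \<Rightarrow> ('a::field ^ 2) set set" where
  "L1 q s = linear_set (graph_of (\<lambda>x. x ^ (q ^ s)))"

text \<open>Only meaningful for \<open>t \<le> 6\<close>, because of the truncated subtraction.\<close>

definition L2 :: "nat \<Rightarrow> nat \<Rightarrow> 'a::field \<Rightarrow> ('a ^ 2) set set" where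
  "L2 q t \<rho> = linear_set (graph_of (\<lambda>x. \<rho> * x ^ (q ^ t) + x ^ (q ^ (6 - t))))"

definition L3 :: "nat \<Rightarrow> nat \<Rightarrow> 'a::field \<Rightarrow> ('a ^ 2) set set" where
  "L3 q h \<xi> = linear_set (graph_of (\<lambda>x. \<xi> * x ^ (q ^ h) + x ^ (q ^ (h + 3))))"

end

theory Submission
  imports Defs "HOL-Analysis.Determinants" "HOL-Computational_Algebra.Polynomial"
begin

text \<open>
  The power sums of the slopes \<open>f x / x\<close> of a linearized polynomial \<open>f\<close> depend only on the linear
  set of \<open>f\<close>, and for exponents with few base-\<open>q\<close> digits, all \<open>0\<close> or \<open>1\<close>, they are explicit
  permanent-like expressions in the coefficients of \<open>f\<close>. If \<open>L_g\<close> is equivalent to the linear set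
  of \<open>f\<close>, then, up to replacing \<open>b\<close> by a conjugate, \<open>L_g\<close> is also the linear set of
  \<open>F = (\<gamma> x + \<delta> f) \<circ> (\<alpha> x + \<beta> f)\<^sup>-\<^sup>1\<close>, so the power sums with exponents \<open>1\<close>, \<open>1 + q^k\<close>, \<open>1 + q + q^2\<close>
  and \<open>1 + q + q^2 + q^3\<close> give \<open>F = a\<^sub>1 x^q + a\<^sub>3 x^(q^3) + a\<^sub>5 x^(q^5)\<close> with all coefficients nonzero,
  \<open>a\<^sub>1 a\<^sub>5^q = b\<close>, \<open>a\<^sub>3^(1+q^3) = 1\<close> and \<open>a\<^sub>3^(q-1) = a\<^sub>1^(q^3-1)\<close>. Comparing coefficients in
  \<open>F \<circ> (\<alpha> x + \<beta> f) = \<gamma> x + \<delta> f\<close> forces \<open>\<alpha> = \<beta> = 0\<close> for the first and third family and \<open>b = 1\<close>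
  for the second, which contradicts \<open>b^2 + b = 1\<close>.
\<close>

section \<open>Linearized polynomials over finite fields\<close>

lemma digits_unique:
  fixes q :: nat
  assumes "\<And>j. j < n \<Longrightarrow> d j < q" "\<And>j. j < n \<Longrightarrow> d' j < q"
    and "(\<Sum>j<n. d j * q ^ j) = (\<Sum>j<n. d' j * q ^ j)" and "j < n"
  shows "d j = d' j"
  using assms
proof (induction n arbitrary: d d' j)
  case (Suc n)
  have shift: "(\<Sum>j<Suc n. f j * q ^ j) = f 0 + q * (\<Sum>j<n. f (Suc j) * q ^ j)" for f :: "nat \<Rightarrow> nat"
    by (simp add: sum.lessThan_Suc_shift sum_distrib_left mult_ac del: sum.lessThan_Suc)
  have eq: "d 0 + q * (\<Sum>j<n. d (Suc j) * q ^ j) = d' 0 + q * (\<Sum>j<n. d' (Suc j) * q ^ j)"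
    using Suc.prems(3) unfolding shift .
  have less: "d 0 < q" "d' 0 < q"
    using Suc.prems(1,2) by auto
  have d0: "d 0 = d' 0"
    using arg_cong[OF eq, of "\<lambda>m. m mod q"] less by simp
  with eq less have "(\<Sum>j<n. d (Suc j) * q ^ j) = (\<Sum>j<n. d' (Suc j) * q ^ j)"
    by simp
  then have "d (Suc i) = d' (Suc i)" if "i < n" for i
    using Suc.IH[of "\<lambda>j. d (Suc j)" "\<lambda>j. d' (Suc j)" i] Suc.prems(1,2) that by simp
  with d0 Suc.prems(4) show ?case
    by (cases j) auto
qed simp

text \<open>Grouping equal exponents turns the left side into a base-\<open>q\<close> expansion
  whose digits are the fibre sizes of \<open>f\<close>. As \<open>card E < q\<close> there is no
  carry, so every element of \<open>E\<close> is hit exactly once. This reduces the expansion of a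
  power sum to permutations.\<close>

lemma sum_powers_eq_imp_bij_betw:
  fixes q :: nat
  assumes E: "E \<subseteq> {..<n}" "card E < q" and f: "f ` E \<subseteq> {..<n}"
    and eq: "(\<Sum>e\<in>E. q ^ f e) = (\<Sum>e\<in>E. q ^ e)"
  shows "bij_betw f E E"
proof -
  have fin: "finite E"
    using E(1) finite_subset by blast
  have count: "(\<Sum>e\<in>E. q ^ h e) = (\<Sum>j<n. card {e \<in> E. h e = j} * q ^ j)"
    if "h ` E \<subseteq> {..<n}" for h :: "nat \<Rightarrow> nat"
    using sum_fun_comp[OF fin _ that, of "\<lambda>j. q ^ j"] by simp
  have le: "card {e \<in> E. h e = j} < q" for h :: "nat \<Rightarrow> nat" and j
    using card_mono[OF fin, of "{e \<in> E. h e = j}"] E(2) by auto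
  have "card {e \<in> E. f e = j} = card {e \<in> E. e = j}" if "j < n" for j
    by (rule digits_unique[of n "\<lambda>j. card {e \<in> E. f e = j}" q "\<lambda>j. card {e \<in> E. e = j}"]) 
      (use le le[of "\<lambda>x. x"] that E(1) count[OF f] count[of "\<lambda>x. x"] eq in simp_all)
  moreover have "{e \<in> E. e = j} = {j}" if "j \<in> E" for j
    using that by auto
  ultimately have "card {e \<in> E. f e = j} = 1" if "j \<in> E" for j
    using that E(1) by auto
  then have "{e \<in> E. f e = j} \<noteq> {}" if "j \<in> E" for j
    using that by (metis card.empty zero_neq_one)
  then have sub: "E \<subseteq> f ` E"
    by blast
  have "card (f ` E) = card E"
    using card_mono[OF finite_imageI[OF fin] sub] card_image_le[OF fin, of f] by linarith
  then show ?thesis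
    using sub fin by (metis bij_betw_def card_subset_eq eq_card_imp_inj_on finite_imageI)
qed

text \<open>The iterates of \<open>h\<close> repeat since there are finitely many functions;
  cancelling by injectivity makes a positive iterate the identity, and the iterate before it inverts
  \<open>h\<close>.\<close>

lemma inverse_closed_under_composition:
  fixes h :: "'a::finite \<Rightarrow> 'a"
  assumes "inj h" and "S h" and "S id" and comp: "\<And>f g. S f \<Longrightarrow> S g \<Longrightarrow> S (f \<circ> g)"
  shows "\<exists>k. S k \<and> h \<circ> k = id"
proof -
  have S: "S (h ^^ m)" for m
    by (induction m) (simp_all only: funpow.simps assms)
  have "finite (range (\<lambda>m. h ^^ m))"
    by (rule finite_subset[OF subset_UNIV]) simp
  then have "\<not> inj (\<lambda>m. h ^^ m)"
    using finite_imageD by blast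
  then obtain i j where ij: "h ^^ i = h ^^ j" "i < j"
    unfolding inj_def by (metis linorder_neqE_nat)
  have "inj (h ^^ i)"
    using \<open>inj h\<close> by (rule inj_fn)
  moreover have "h ^^ i \<circ> h ^^ (j - i) = h ^^ i \<circ> id"
    using ij(2) unfolding funpow_add[symmetric] by (simp add: ij(1))
  ultimately have "h ^^ (j - i) = id"
    by (simp add: fun_eq_iff inj_eq)
  then have "h \<circ> h ^^ (j - i - 1) = id"
    using ij(2) by (metis Suc_diff_1 funpow.simps(2) zero_less_diff)
  with S show ?thesis
    by blast
qed

text \<open>For \<open>f 0 = 0\<close> this is the linear set of \<open>graph_of f\<close> in the
  affine coordinate \<open>y / x\<close>: no nonzero vector of the graph has first coordinate
  \<open>0\<close>.\<close>

definition slopes :: "('a::field \<Rightarrow> 'a) \<Rightarrow> 'a set" where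
  "slopes f = (\<lambda>x. f x / x) ` (- {0})"

text \<open>Translation by \<open>x\<close> permutes \<open>V\<close>, so it preserves the sum over
  \<open>V\<close> and \<open>card V\<close> times \<open>x\<close> is zero.\<close>

lemma card_additive_subgroup_eq_0:
  fixes V :: "'a::{field,finite} set"
  assumes add: "\<And>x y. x \<in> V \<Longrightarrow> y \<in> V \<Longrightarrow> x + y \<in> V"
    and minus: "\<And>x. x \<in> V \<Longrightarrow> - x \<in> V"
    and x: "x \<in> V" "x \<noteq> 0"
  shows "of_nat (card V) = (0 :: 'a)"
proof -
  have "(\<Sum>v\<in>V. v) = (\<Sum>v\<in>V. v + x)"
    by (rule sum.reindex_bij_witness[of _ "\<lambda>v. v + x" "\<lambda>v. v - x"])
      (use add minus x in \<open>auto simp: diff_conv_add_uminus simp del: add_uminus_conv_diff\<close>)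
  then have "of_nat (card V) * x = 0"
    by (simp add: sum.distrib)
  with x show ?thesis
    by simp
qed

text \<open>The \<open>x\<close> with \<open>f x = z * x\<close> form a nontrivial additive group, so each slope \<open>z\<close> is
  attained \<open>-1\<close> times modulo the characteristic, whatever its multiplicity.\<close>

lemma sum_slopes:
  fixes f \<phi> :: "'a::{field,finite} \<Rightarrow> 'a"
  assumes add: "\<And>x y. f (x + y) = f x + f y"
  shows "(\<Sum>x\<in>-{0}. \<phi> (f x / x)) = - (\<Sum>z\<in>slopes f. \<phi> z)"
proof -
  have f0: "f 0 = 0"
    using add[of 0 0] by (metis add.right_neutral add_left_cancel)
  have fm: "f (- x) = - f x" for x
    using add[of x "- x"] f0 by (simp add: eq_neg_iff_add_eq_0 add.commute)
  have fibre: "of_nat (card {x \<in> -{0}. f x / x = z}) = (-1 :: 'a)" if z: "z \<in> slopes f" for z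
  proof -
    let ?V = "{x. f x = z * x}"
    from z obtain x where "x \<noteq> 0" "z = f x / x"
      unfolding slopes_def by auto
    then have x: "x \<noteq> 0" "f x = z * x"
      by auto
    have "of_nat (card ?V) = (0 :: 'a)"
      by (rule card_additive_subgroup_eq_0[of _ x]) (use x in \<open>auto simp: add fm algebra_simps\<close>)
    moreover have "?V = insert 0 {x \<in> -{0}. f x / x = z}"
      using f0 by (auto simp: field_simps)
    ultimately have "of_nat (Suc (card {x \<in> -{0}. f x / x = z})) = (0 :: 'a)"
      by (metis (no_types, lifting) ComplD card_insert_disjoint finite insertI1 mem_Collect_eq)
    then show ?thesis
      by (simp add: eq_neg_iff_add_eq_0 add.commute)
  qed
  have "(\<Sum>x\<in>-{0}. \<phi> (f x / x)) = (\<Sum>z\<in>slopes f. of_nat (card {x \<in> -{0}. f x / x = z}) * \<phi> z)"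
    by (rule sum_fun_comp) (auto simp: slopes_def)
  also have "\<dots> = (\<Sum>z\<in>slopes f. - \<phi> z)"
    by (rule sum.cong) (use fibre in auto)
  finally show ?thesis
    by (simp add: sum_negf)
qed

section \<open>Frobenius powers and linearized polynomials\<close>

lemma finite_field_power_card:
  fixes x :: "'a::{field,finite}"
  shows "x ^ CARD('a) = x"
proof (cases "x = 0")
  case False
  have "(\<Prod>y\<in>-{0}. y) = (\<Prod>y\<in>-{0}. x * y)"
    by (rule prod.reindex_bij_witness[of _ "\<lambda>y. x * y" "\<lambda>y. y / x"]) (use False in auto)
  then have "x ^ card (- {0 :: 'a}) = 1"
    by (simp add: prod.distrib)
  moreover have "CARD('a) = Suc (card (- {0 :: 'a}))"
    by (simp add: Compl_eq_Diff_UNIV card_Diff_singleton)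
  ultimately show ?thesis
    by simp
qed simp

locale finite_field_ext =
  fixes T :: "'a::{field,finite} itself" and q n :: nat
  assumes primepow_q: "primepow q" and card_field: "CARD('a) = q ^ n"
begin

lemma q_gt_1: "q > 1"
  using primepow_gt_Suc_0[OF primepow_q] by simp

lemma q_pos [simp]: "0 < q" "q \<noteq> 0"
  using q_gt_1 by simp_all

lemma n_pos: "n > 0"
proof (rule ccontr)
  assume "\<not> n > 0"
  then have "CARD('a) = 1"
    using card_field by simp
  then have "(0 :: 'a) = 1"
    by (metis UNIV_I card_1_singletonE singletonD)
  then show False
    by simp
qed

lemma q_eq_CHAR_power: "prime CHAR('a)" "\<exists>k. q = CHAR('a) ^ k"
proof -
  show prime: "prime CHAR('a)"
    using finite_imp_CHAR_pos[where 'a = 'a] prime_CHAR_semidom[where 'a = 'a] by simp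
  obtain p k where p: "prime p" "q = p ^ k"
    using primepow_q unfolding primepow_def by blast
  have "CHAR('a) dvd p ^ (k * n)"
    using CHAR_dvd_CARD[where 'a = 'a] p card_field by (simp add: power_mult)
  then have "CHAR('a) = p"
    using prime p(1) by (metis prime_dvd_power primes_dvd_imp_eq)
  then show "\<exists>k. q = CHAR('a) ^ k"
    using p by blast
qed

lemma power_q_sum: "(sum f A :: 'a) ^ (q ^ e) = (\<Sum>i\<in>A. f i ^ (q ^ e))"
proof -
  obtain k where "q = CHAR('a) ^ k"
    using q_eq_CHAR_power by blast
  then have "q ^ e = CHAR('a) ^ (k * e)"
    by (simp add: power_mult)
  then show ?thesis
    using freshmans_dream_sum'[OF q_eq_CHAR_power(1)] by blast
qed

lemma power_q_add: "(x + y :: 'a) ^ (q ^ e) = x ^ (q ^ e) + y ^ (q ^ e)"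
  using power_q_sum[of "\<lambda>b. if b then x else y" UNIV e] by (simp add: UNIV_bool add.commute)

lemma power_q_power_q: "((x :: 'a) ^ (q ^ i)) ^ (q ^ j) = x ^ (q ^ (i + j))"
  by (simp add: power_add power_mult)

lemma power_q_mod: "(x :: 'a) ^ (q ^ m) = x ^ (q ^ (m mod n))"
proof -
  have "x ^ (q ^ (n * k)) = x" for k
    by (induction k) (simp_all add: power_add power_mult finite_field_power_card flip: card_field)
  then have "x ^ (q ^ (n * (m div n) + m mod n)) = x ^ (q ^ (m mod n))"
    by (simp only: power_q_power_q[symmetric])
  then show ?thesis
    by simp
qed

text \<open>Linearized polynomials reduced modulo \<open>x ^ (q ^ n) - x\<close>; the values of
  \<open>a\<close> from index \<open>n\<close> on are ignored.\<close>

definition qpoly :: "(nat \<Rightarrow> 'a) \<Rightarrow> 'a \<Rightarrow> 'a" where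
  "qpoly a x = (\<Sum>i<n. a i * x ^ (q ^ i))"

lemma qpoly_add: "qpoly a (x + y) = qpoly a x + qpoly a y"
  by (simp add: qpoly_def power_q_add algebra_simps sum.distrib)

lemma qpoly_coeff_add: "qpoly (\<lambda>i. a i + c i) x = qpoly a x + qpoly c x"
  by (simp add: qpoly_def algebra_simps sum.distrib)

lemma qpoly_smult: "qpoly (\<lambda>i. k * a i) x = k * qpoly a x"
  by (simp add: qpoly_def sum_distrib_left mult_ac)

lemma qpoly_monom: "qpoly (\<lambda>i. if i = m mod n then 1 else 0) x = x ^ (q ^ m)"
proof -
  have "qpoly (\<lambda>i. if i = m mod n then 1 else 0) x = (\<Sum>i<n. if i = m mod n then x ^ (q ^ i) else 0)"
    unfolding qpoly_def by (intro sum.cong) auto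
  also have "\<dots> = x ^ (q ^ m)"
    using n_pos by (simp flip: power_q_mod)
  finally show ?thesis .
qed

text \<open>A Frobenius power rotates the coefficients cyclically and conjugates them; the summand
  \<open>n\<close> keeps the subtraction of \<open>e\<close> from being truncated.\<close>

lemma qpoly_power:
  assumes "e < n"
  shows "qpoly a x ^ (q ^ e) = (\<Sum>j<n. a ((j + n - e) mod n) ^ (q ^ e) * x ^ (q ^ j))"
proof -
  have "qpoly a x ^ (q ^ e) = (\<Sum>i<n. a i ^ (q ^ e) * x ^ (q ^ ((i + e) mod n)))"
    by (simp add: qpoly_def power_q_sum power_mult_distrib power_q_power_q flip: power_q_mod)
  also have "\<dots> = (\<Sum>j<n. a ((j + n - e) mod n) ^ (q ^ e) * x ^ (q ^ j))"
  proof (rule sum.reindex_bij_witness[of _ "\<lambda>j. (j + n - e) mod n" "\<lambda>i. (i + e) mod n"])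
    fix i assume "i \<in> {..<n}"
    then show i: "((i + e) mod n + n - e) mod n = i"
      using assms by (cases "i + e < n") (auto simp: mod_if)
    then show "a (((i + e) mod n + n - e) mod n) ^ q ^ e * x ^ q ^ ((i + e) mod n) =
        a i ^ q ^ e * x ^ q ^ ((i + e) mod n)"
      by simp
  next
    fix j assume "j \<in> {..<n}"
    then show "((j + n - e) mod n + e) mod n = j"
      using assms by (cases "j < e") (auto simp: mod_if)
  qed (use n_pos in auto)
  finally show ?thesis .
qed

lemma qpoly_comp:
  "qpoly a (qpoly c x) = qpoly (\<lambda>m. \<Sum>i<n. a i * c ((m + n - i) mod n) ^ (q ^ i)) x"
proof -
  have "qpoly a (qpoly c x) = (\<Sum>i<n. \<Sum>m<n. a i * (c ((m + n - i) mod n) ^ (q ^ i) * x ^ (q ^ m)))"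
    unfolding qpoly_def[of a] by (simp add: qpoly_power sum_distrib_left)
  also have "\<dots> = (\<Sum>m<n. \<Sum>i<n. a i * (c ((m + n - i) mod n) ^ (q ^ i) * x ^ (q ^ m)))"
    by (rule sum.swap)
  also have "\<dots> = qpoly (\<lambda>m. \<Sum>i<n. a i * c ((m + n - i) mod n) ^ (q ^ i)) x"
    by (simp add: qpoly_def sum_distrib_right mult.assoc)
  finally show ?thesis .
qed

text \<open>The difference is a polynomial of degree at most \<open>q ^ (n - 1)\<close> that
  vanishes at all \<open>q ^ n\<close> field elements.\<close>

lemma qpoly_coeff_unique:
  assumes eq: "\<And>x. qpoly a x = qpoly c x" and i: "i < n"
  shows "a i = c i"
proof -
  define P where "P = (\<Sum>i<n. Polynomial.monom (a i - c i) (q ^ i))"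
  have coeff: "Polynomial.coeff P (q ^ i) = a i - c i"
  proof -
    have "Polynomial.coeff P (q ^ i) = (\<Sum>j<n. if j = i then a i - c i else 0)"
      unfolding P_def coeff_sum by (intro sum.cong) (use q_gt_1 in auto)
    then show ?thesis
      using i by simp
  qed
  have "Polynomial.degree P \<le> q ^ (n - 1)"
    unfolding P_def
    by (intro degree_sum_le order.trans[OF degree_monom_le] power_increasing) (use q_gt_1 in auto)
  also have "\<dots> < q ^ n"
    using q_gt_1 n_pos by simp
  finally have "Polynomial.degree P < q ^ n" .
  moreover have "poly P x = 0" for x
    using eq[of x]
    by (simp add: P_def poly_sum poly_monom qpoly_def left_diff_distrib sum_subtractf)
  then have "{x. poly P x = 0} = UNIV"
    by simp
  ultimately have "P = 0"
    using card_poly_roots_bound[of P] card_field by force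
  with coeff show ?thesis
    by simp
qed

lemma inj_qpoly_inverse:
  assumes "inj (qpoly a)"
  shows "\<exists>c. \<forall>x. qpoly a (qpoly c x) = x"
proof -
  have id: "id = qpoly (\<lambda>i. if i = 0 mod n then 1 else 0)"
    unfolding fun_eq_iff qpoly_monom by simp
  \<comment> \<open>The inverse is an iterate of \<open>qpoly a\<close>, hence again
    linearized.\<close>
  have "\<exists>k. (\<exists>c. k = qpoly c) \<and> qpoly a \<circ> k = id"
    by (rule inverse_closed_under_composition[OF assms])
      (use id in \<open>auto simp: fun_eq_iff qpoly_comp\<close>)
  then show ?thesis
    by (metis comp_apply id_apply)
qed

section \<open>Power sums of slopes as permanents\<close>

lemma sum_power_quotient:
  fixes A B :: nat
  assumes "A < B + (q ^ n - 1)" "B < A + (q ^ n - 1)"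
  shows "(\<Sum>x\<in>-{0 :: 'a}. x ^ A / x ^ B) = (if A = B then -1 else 0)"
proof (cases "A = B")
  case True
  have "(\<Sum>x\<in>-{0 :: 'a}. x ^ A / x ^ B) = (\<Sum>x\<in>-{0 :: 'a}. 1)"
    using True by (intro sum.cong) auto
  also have "\<dots> = of_nat (card (- {0 :: 'a}))"
    by simp
  also have "card (- {0 :: 'a}) = CARD('a) - 1"
    by (simp add: Compl_eq_Diff_UNIV card_Diff_singleton)
  also have "of_nat (CARD('a) - 1) = (of_nat CARD('a) - 1 :: 'a)"
    by (simp add: of_nat_diff)
  also have "\<dots> = -1"
    using CHAR_dvd_CARD[where 'a = 'a] by (simp add: of_nat_eq_0_iff_char_dvd)
  finally show ?thesis
    using True by simp
next
  case False
  \<comment> \<open>Otherwise all \<open>q ^ n - 1\<close> nonzero elements would be roots of a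
    polynomial of the smaller degree \<open>m\<close>, the distance of \<open>A\<close> and
    \<open>B\<close>. Scaling by such a \<open>y\<close> multiplies the sum by a factor other than
    \<open>1\<close>, so the sum vanishes.\<close>
  have "\<exists>y :: 'a. y \<noteq> 0 \<and> y ^ A \<noteq> y ^ B"
  proof (rule ccontr)
    assume "\<not> ?thesis"
    then have eq: "y ^ A = y ^ B" if "y \<noteq> 0" for y :: 'a
      using that by blast
    define m where "m = (if A < B then B - A else A - B)"
    have m: "0 < m" "m < q ^ n - 1"
      using False assms by (auto simp: m_def)
    have "y ^ m = 1" if "y \<noteq> 0" for y :: 'a
      using eq[OF that] that by (auto simp: m_def power_diff)
    then have "- {0} \<subseteq> {y. poly (Polynomial.monom 1 m - 1) y = (0 :: 'a)}"
      by (auto simp: poly_monom)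
    then have "card (- {0 :: 'a}) \<le> card {y. poly (Polynomial.monom 1 m - 1) y = (0 :: 'a)}"
      by (intro card_mono) auto
    also have "\<dots> \<le> Polynomial.degree (Polynomial.monom 1 m - 1 :: 'a poly)"
    proof (rule card_poly_roots_bound)
      have "Polynomial.coeff (Polynomial.monom 1 m - 1 :: 'a poly) m = 1"
        using m by (simp add: coeff_1)
      then show "Polynomial.monom 1 m - 1 \<noteq> (0 :: 'a poly)"
        by (metis coeff_0 zero_neq_one)
    qed
    also have "\<dots> \<le> m"
      by (intro degree_diff_le) (auto simp: degree_monom_le)
    finally show False
      using m card_field by (simp add: Compl_eq_Diff_UNIV card_Diff_singleton)
  qed
  then obtain y :: 'a where y: "y \<noteq> 0" "y ^ A \<noteq> y ^ B"
    by blast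
  let ?S = "\<Sum>x\<in>-{0 :: 'a}. x ^ A / x ^ B"
  have "?S = (\<Sum>x\<in>-{0 :: 'a}. (y * x) ^ A / (y * x) ^ B)"
    by (rule sum.reindex_bij_witness[of _ "\<lambda>x. y * x" "\<lambda>x. x / y"]) (use y in auto)
  also have "\<dots> = y ^ A / y ^ B * ?S"
    by (simp add: power_mult_distrib sum_distrib_left)
  finally have "?S * (1 - y ^ A / y ^ B) = 0"
    by (simp add: algebra_simps)
  with y False show ?thesis
    by (simp add: field_simps)
qed

text \<open>The permanent of the matrix indexed by \<open>E\<close> whose entry in row
  \<open>e\<close> and column \<open>j\<close> is the coefficient of \<open>x ^ (q ^ j)\<close> in
  \<open>qpoly a x ^ (q ^ e)\<close>.\<close>

definition coeff_sum :: "(nat \<Rightarrow> 'a) \<Rightarrow> nat set \<Rightarrow> 'a" where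
  "coeff_sum a E = (\<Sum>p | p permutes E. \<Prod>e\<in>E. a ((p e + n - e) mod n) ^ (q ^ e))"

text \<open>The power is a product of Frobenius powers. Expanding it means choosing a term
  \<open>f e\<close> for every \<open>e\<close>; summing over \<open>x\<close> keeps only the
  choices that reproduce the exponent in the denominator, and these are the permutations of
  \<open>E\<close>.\<close>

lemma power_sum_qpoly:
  assumes E: "E \<subseteq> {..<n}" "card E < q"
  shows "(\<Sum>x\<in>-{0 :: 'a}. (qpoly a x / x) ^ (\<Sum>e\<in>E. q ^ e)) =
    - coeff_sum a E"
proof -
  let ?c = "\<lambda>e j. a ((j + n - e) mod n) ^ (q ^ e)"
  let ?B = "\<Sum>e\<in>E. q ^ e"
  let ?Pi = "PiE E (\<lambda>_. {..<n})"
  have fin: "finite E"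
    using E(1) finite_subset by blast
  \<comment> \<open>With the positivity below, this keeps the difference of two exponents under
    \<open>q ^ n - 1\<close>, as \<open>sum_power_quotient\<close> requires.\<close>
  have less: "(\<Sum>e\<in>E. q ^ f e) < q ^ n" if "f ` E \<subseteq> {..<n}" for f
  proof -
    have "(\<Sum>e\<in>E. q ^ f e) \<le> (\<Sum>e\<in>E. q ^ (n - 1))"
      by (intro sum_mono power_increasing) (use q_gt_1 that n_pos in fastforce)+
    also have "\<dots> = card E * q ^ (n - 1)"
      by simp
    also have "\<dots> < q * q ^ (n - 1)"
      using E(2) q_gt_1 by (intro mult_strict_right_mono) auto
    also have "\<dots> = q ^ n"
      using n_pos by (metis Suc_diff_1 power_Suc)
    finally show ?thesis .
  qed
  have pos: "(\<Sum>e\<in>E. q ^ f e) > 0" if "E \<noteq> {}" for f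
    using q_gt_1 fin that by (intro sum_pos) auto
  have "(\<Sum>x\<in>-{0 :: 'a}. (qpoly a x / x) ^ ?B) =
      (\<Sum>x\<in>-{0}. \<Sum>f\<in>?Pi. (\<Prod>e\<in>E. ?c e (f e)) * (x ^ (\<Sum>e\<in>E. q ^ f e) / x ^ ?B))"
  proof (rule sum.cong)
    fix x :: 'a assume "x \<in> - {0}"
    have "(qpoly a x / x) ^ ?B = (\<Prod>e\<in>E. qpoly a x ^ (q ^ e)) / x ^ ?B"
      by (simp only: power_divide power_sum prod_dividef)
    also have "(\<Prod>e\<in>E. qpoly a x ^ (q ^ e)) = (\<Prod>e\<in>E. \<Sum>j<n. ?c e j * x ^ (q ^ j))"
      by (intro prod.cong) (use E qpoly_power in auto)
    also have "\<dots> = (\<Sum>f\<in>?Pi. \<Prod>e\<in>E. ?c e (f e) * x ^ (q ^ f e))"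
      using fin by (rule prod_sum_PiE) simp
    also have "\<dots> / x ^ ?B = (\<Sum>f\<in>?Pi. (\<Prod>e\<in>E. ?c e (f e)) * (x ^ (\<Sum>e\<in>E. q ^ f e) / x ^ ?B))"
      by (simp add: sum_divide_distrib prod.distrib power_sum)
    finally show "(qpoly a x / x) ^ ?B = \<dots>" .
  qed simp
  also have "\<dots> = (\<Sum>f\<in>?Pi. (\<Prod>e\<in>E. ?c e (f e)) * (\<Sum>x\<in>-{0}. x ^ (\<Sum>e\<in>E. q ^ f e) / x ^ ?B))"
    by (subst sum.swap) (simp add: sum_distrib_left)
  also have "\<dots> = (\<Sum>f\<in>?Pi. if (\<Sum>e\<in>E. q ^ f e) = ?B then - (\<Prod>e\<in>E. ?c e (f e)) else 0)"
  proof (rule sum.cong)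
    fix f assume "f \<in> ?Pi"
    then have f: "f ` E \<subseteq> {..<n}"
      by auto
    have "(\<Sum>e\<in>E. q ^ f e) < ?B + (q ^ n - 1) \<and> ?B < (\<Sum>e\<in>E. q ^ f e) + (q ^ n - 1)"
    \<comment> \<open>For empty \<open>E\<close> both exponents are \<open>0\<close> and positivity
      fails, but then \<open>q ^ n > 1\<close> suffices.\<close>
    proof (cases "E = {}")
      case True
      then show ?thesis
        using one_less_power[OF q_gt_1 n_pos] by simp
    next
      case False
      then show ?thesis
        using less[OF f] pos[of f] less[of "\<lambda>x. x"] pos[of "\<lambda>x. x"] E(1) by auto
    qed
    then have "(\<Sum>x\<in>-{0 :: 'a}. x ^ (\<Sum>e\<in>E. q ^ f e) / x ^ ?B) =
        (if (\<Sum>e\<in>E. q ^ f e) = ?B then -1 else 0)"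
      by (intro sum_power_quotient) auto
    then show "(\<Prod>e\<in>E. ?c e (f e)) * (\<Sum>x\<in>-{0}. x ^ (\<Sum>e\<in>E. q ^ f e) / x ^ ?B) =
        (if (\<Sum>e\<in>E. q ^ f e) = ?B then - (\<Prod>e\<in>E. ?c e (f e)) else 0)"
      by simp
  qed simp
  also have "\<dots> = (\<Sum>f\<in>{f \<in> ?Pi. (\<Sum>e\<in>E. q ^ f e) = ?B}. - (\<Prod>e\<in>E. ?c e (f e)))"
    by (rule sum.inter_filter[symmetric]) (use fin in \<open>auto intro: finite_PiE\<close>)
  also have "\<dots> = (\<Sum>p | p permutes E. - (\<Prod>e\<in>E. ?c e (p e)))"
  proof (rule sum.reindex_bij_witness[of _ "\<lambda>p. restrict p E" "\<lambda>f x. if x \<in> E then f x else x"])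
    fix f assume f: "f \<in> {f \<in> ?Pi. (\<Sum>e\<in>E. q ^ f e) = ?B}"
    then have "bij_betw f E E"
      by (intro sum_powers_eq_imp_bij_betw[OF E]) auto
    then have "bij_betw (\<lambda>x. if x \<in> E then f x else x) E E"
      by (subst bij_betw_cong[of _ _ f]) auto
    then show "(\<lambda>x. if x \<in> E then f x else x) \<in> {p. p permutes E}"
      by (simp add: bij_imp_permutes)
    show "restrict (\<lambda>x. if x \<in> E then f x else x) E = f"
      using f by (auto simp: fun_eq_iff PiE_def extensional_def)
  next
    fix p assume "p \<in> {p. p permutes E}"
    then have p: "p permutes E"
      by simp
    show "(\<lambda>x. if x \<in> E then restrict p E x else x) = p"
      using p by (auto simp: fun_eq_iff permutes_def)
    have "(\<Sum>e\<in>E. q ^ p e) = ?B"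
      using sum.permute[OF p, of "\<lambda>e. q ^ e"] by (simp add: comp_def)
    then show "restrict p E \<in> {f \<in> ?Pi. (\<Sum>e\<in>E. q ^ f e) = ?B}"
      using p E(1) permutes_in_image[OF p] by auto
  qed (auto intro: prod.cong)
  finally show ?thesis
    by (simp add: sum_negf coeff_sum_def)
qed

text \<open>By \<open>sum_slopes\<close> a power sum sees only the set of slopes, not their
  multiplicities.\<close>

corollary slopes_eq_imp_coeff_sum_eq:
  assumes "slopes (qpoly a) = slopes (qpoly c)" "E \<subseteq> {..<n}" "card E < q"
  shows "coeff_sum a E = coeff_sum c E"
  using sum_slopes[of "qpoly a" "\<lambda>z. z ^ (\<Sum>e\<in>E. q ^ e)", OF qpoly_add]
    sum_slopes[of "qpoly c" "\<lambda>z. z ^ (\<Sum>e\<in>E. q ^ e)", OF qpoly_add]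
    assms(1) power_sum_qpoly[OF assms(2,3)]
  by simp

end

section \<open>Equivalence of linear sets in terms of slopes\<close>

lemma span_vector_eq_iff:
  fixes u v :: "'a::field ^ 2"
  assumes "u \<noteq> 0"
  shows "vec.span {u} = vec.span {v} \<longleftrightarrow> (\<exists>k. k \<noteq> 0 \<and> u = k *s v)"
proof
  assume "vec.span {u} = vec.span {v}"
  then have "u \<in> vec.span {v}"
    by (metis insertI1 vec.span_base)
  then obtain k where k: "u = k *s v"
    by (auto simp: vec.span_singleton)
  with assms have "k \<noteq> 0"
    by auto
  with k show "\<exists>k. k \<noteq> 0 \<and> u = k *s v"
    by blast
next
  assume "\<exists>k. k \<noteq> 0 \<and> u = k *s v"
  then obtain k where k: "k \<noteq> 0" "u = k *s v"
    by blast
  then have "v = inverse k *s u"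
    by (simp add: vector_smult_assoc)
  then have "v \<in> vec.span {u}"
    unfolding vec.span_singleton by (rule range_eqI)
  moreover have "u \<in> vec.span {v}"
    unfolding vec.span_singleton using k(2) by (rule range_eqI)
  ultimately show "vec.span {u} = vec.span {v}"
    by (simp add: vec.span_eq)
qed

lemma vector_2_eq_iff: "(vector [x, y] :: 'a::zero ^ 2) = v \<longleftrightarrow> x = v $ 1 \<and> y = v $ 2"
  by (auto simp: vec_eq_iff forall_2)

lemma linear_set_graph:
  "linear_set (graph_of f) = (\<lambda>x. vec.span {vector [x, f x]}) ` (- {0})" if "f 0 = 0"
proof -
  have "graph_of f - {0} = (\<lambda>x. vector [x, f x]) ` (- {0})"
    using that by (auto simp: graph_of_def vector_2_eq_iff)
  then show ?thesis
    by (simp add: linear_set_def image_image)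
qed

lemma semilinear_map_span:
  assumes "surj \<sigma>" "\<And>x y. \<sigma> (x * y) = \<sigma> x * \<sigma> y"
  shows "semilinear_map A \<sigma> ` vec.span {v} = vec.span {semilinear_map A \<sigma> v}"
proof -
  have "semilinear_map A \<sigma> (k *s v) = \<sigma> k *s semilinear_map A \<sigma> v" for k
  proof -
    have "(\<chi> i. \<sigma> ((k *s v) $ i)) = \<sigma> k *s (\<chi> i. \<sigma> (v $ i))"
      by (simp add: vec_eq_iff assms(2))
    then show ?thesis
      by (simp add: semilinear_map_def vector_scalar_commute)
  qed
  then have "semilinear_map A \<sigma> ` vec.span {v} = (\<lambda>k. k *s semilinear_map A \<sigma> v) ` range \<sigma>"
    by (simp add: vec.span_singleton image_image)
  with assms(1) show ?thesis
    by (simp add: vec.span_singleton)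
qed

lemma field_automorphismD:
  fixes \<sigma> :: "'a::field \<Rightarrow> 'a"
  assumes "field_automorphism \<sigma>"
  shows "surj \<sigma>" "inj \<sigma>" "\<sigma> 1 = 1" "\<sigma> (x + y) = \<sigma> x + \<sigma> y" "\<sigma> (x * y) = \<sigma> x * \<sigma> y"
    "\<sigma> 0 = 0" "\<sigma> x = 0 \<longleftrightarrow> x = 0" "\<sigma> (x / y) = \<sigma> x / \<sigma> y" "\<sigma> (x ^ k) = \<sigma> x ^ k"
proof -
  show inj: "inj \<sigma>" and "surj \<sigma>" and one: "\<sigma> 1 = 1"
    and add: "\<sigma> (x + y) = \<sigma> x + \<sigma> y" and mult: "\<sigma> (x * y) = \<sigma> x * \<sigma> y" for x y
    using assms by (auto simp: field_automorphism_def bij_def)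
  show zero: "\<sigma> 0 = 0"
    using add[of 0 0] by (metis add.right_neutral add_left_cancel)
  show eq_0: "\<sigma> x = 0 \<longleftrightarrow> x = 0" for x
    using inj zero by (metis injD)
  show "\<sigma> (x / y) = \<sigma> x / \<sigma> y"
    using mult[of "x / y" y] by (cases "y = 0") (simp_all add: zero eq_0 field_simps)
  show "\<sigma> (x ^ k) = \<sigma> x ^ k"
    by (induction k) (simp_all add: one mult)
qed

text \<open>The Greek coefficients are the entries of the inverse matrix \<open>B\<close>. The point
  of \<open>x\<close> goes to the point of \<open>y\<close> exactly when
  \<open>(\<sigma> x, \<sigma> (g x))\<close> is proportional to \<open>B\<close> applied to
  \<open>(y, f y)\<close>; the ratio of the coordinates then gives the slopes.\<close>

lemma PGammaL_equivalent_graphs: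
  fixes f g :: "'a::field \<Rightarrow> 'a"
  assumes equiv: "PGammaL_equivalent (linear_set (graph_of g)) (linear_set (graph_of f))"
    and f0: "f 0 = 0" and g0: "g 0 = 0"
  shows "\<exists>\<sigma> \<alpha> \<beta> \<gamma> \<delta>. field_automorphism \<sigma> \<and> \<alpha> * \<delta> - \<beta> * \<gamma> \<noteq> 0 \<and>
    (\<forall>y. y \<noteq> 0 \<longrightarrow> \<alpha> * y + \<beta> * f y \<noteq> 0) \<and>
    (\<lambda>y. (\<gamma> * y + \<delta> * f y) / (\<alpha> * y + \<beta> * f y)) ` (- {0}) = \<sigma> ` slopes g"
proof -
  obtain A \<sigma> where A: "invertible A" and \<sigma>: "field_automorphism \<sigma>"
    and image: "restrict (image (semilinear_map A \<sigma>)) PG1_points ` linear_set (graph_of g) =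
      linear_set (graph_of f)"
    using equiv unfolding PGammaL_equivalent_def PGammaL_def by blast
  note \<sigma>_props = field_automorphismD[OF \<sigma>]
  obtain B where B: "A ** B = mat 1" "B ** A = mat 1"
    using A unfolding invertible_def by blast
  then have "invertible B"
    unfolding invertible_def by blast
  define \<alpha> \<beta> \<gamma> \<delta> where coeffs: "\<alpha> = B $ 1 $ 1" "\<beta> = B $ 1 $ 2" "\<gamma> = B $ 2 $ 1" "\<delta> = B $ 2 $ 2"
  have det: "\<alpha> * \<delta> - \<beta> * \<gamma> \<noteq> 0"
    using \<open>invertible B\<close> by (simp add: invertible_det_nz det_2 coeffs)
  have B_mult: "B *v vector [x, y] = vector [\<alpha> * x + \<beta> * y, \<gamma> * x + \<delta> * y]" for x y
    by (simp add: vec_eq_iff forall_2 matrix_vector_mult_def sum_2 coeffs)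
  have BA: "A *v u = k *s v \<longleftrightarrow> u = k *s (B *v v)" for u v k
  proof
    assume "A *v u = k *s v"
    then have "B *v (A *v u) = k *s (B *v v)"
      by (simp add: vector_scalar_commute)
    then show "u = k *s (B *v v)"
      by (simp add: matrix_vector_mul_assoc B)
  next
    assume "u = k *s (B *v v)"
    then show "A *v u = k *s v"
      by (simp add: vector_scalar_commute[symmetric] matrix_vector_mul_assoc B)
  qed
  \<comment> \<open>For \<open>x \<noteq> 0\<close>, \<open>P x y\<close> means that the
    collineation sends the point of \<open>x\<close> to the point of \<open>y\<close>.\<close>
  define P where "P x y \<longleftrightarrow> (\<exists>k. k \<noteq> 0 \<and> \<sigma> x = k * (\<alpha> * y + \<beta> * f y) \<and> \<sigma> (g x) = k * (\<gamma> * y + \<delta> * f y))"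
    for x y
  have point: "semilinear_map A \<sigma> ` vec.span {vector [x, g x]} = vec.span {vector [y, f y]} \<longleftrightarrow> P x y"
    if "x \<noteq> 0" for x y
  proof -
    let ?u = "vector [\<sigma> x, \<sigma> (g x)] :: 'a ^ 2"
    have u: "(\<chi> i. \<sigma> ((vector [x, g x] :: 'a ^ 2) $ i)) = ?u"
      by (simp add: vec_eq_iff forall_2)
    have "A *v ?u \<noteq> 0"
      using BA[of ?u 0 0] that \<sigma>_props(7)[of x] by (auto simp: vector_2_eq_iff)
    then have "vec.span {A *v ?u} = vec.span {vector [y, f y]} \<longleftrightarrow> P x y"
      by (simp add: span_vector_eq_iff BA B_mult vector_2_eq_iff P_def)
    then show ?thesis
      unfolding semilinear_map_span[OF \<sigma>_props(1,5)] unfolding semilinear_map_def u .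
  qed
  have "linear_set (graph_of g) \<subseteq> PG1_points"
    by (auto simp: linear_set_def PG1_points_def)
  then have "restrict (image (semilinear_map A \<sigma>)) PG1_points ` linear_set (graph_of g) =
      image (semilinear_map A \<sigma>) ` linear_set (graph_of g)"
    by (intro image_cong) auto
  with image have image': "(\<lambda>x. semilinear_map A \<sigma> ` vec.span {vector [x, g x]}) ` (- {0}) =
      (\<lambda>y. vec.span {vector [y, f y]}) ` (- {0})"
    by (simp add: linear_set_graph f0 g0 image_image)
  have to_y: "\<exists>y. y \<noteq> 0 \<and> P x y" if "x \<noteq> 0" for x
  proof -
    have "semilinear_map A \<sigma> ` vec.span {vector [x, g x]} \<in> (\<lambda>y. vec.span {vector [y, f y]}) ` (- {0})"
      unfolding image'[symmetric] using that by blast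
    then obtain y where "y \<noteq> 0"
      "semilinear_map A \<sigma> ` vec.span {vector [x, g x]} = vec.span {vector [y, f y]}"
      by auto
    then show ?thesis
      using point[OF that] by blast
  qed
  have to_x: "\<exists>x. x \<noteq> 0 \<and> P x y" if "y \<noteq> 0" for y
  proof -
    have "vec.span {vector [y, f y]} \<in> (\<lambda>x. semilinear_map A \<sigma> ` vec.span {vector [x, g x]}) ` (- {0})"
      unfolding image' using that by blast
    then show ?thesis
      using point by (metis (no_types, lifting) ComplD imageE insertI1)
  qed
  \<comment> \<open>A zero here would force \<open>\<sigma> x = 0\<close> for some
    \<open>x \<noteq> 0\<close>.\<close>
  have nz: "\<alpha> * y + \<beta> * f y \<noteq> 0" if "y \<noteq> 0" for y
    using to_x[OF that] \<sigma>_props(7) unfolding P_def by (metis mult_zero_right)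
  have slope: "(\<gamma> * y + \<delta> * f y) / (\<alpha> * y + \<beta> * f y) = \<sigma> (g x / x)"
    if "P x y" "x \<noteq> 0" "y \<noteq> 0" for x y
    using that nz[OF that(3)] unfolding P_def by (auto simp: \<sigma>_props(8))
  have "(\<lambda>y. (\<gamma> * y + \<delta> * f y) / (\<alpha> * y + \<beta> * f y)) ` (- {0}) = (\<lambda>x. \<sigma> (g x / x)) ` (- {0})"
  proof (intro equalityI subsetI; elim imageE)
    fix z y assume z: "z = (\<gamma> * y + \<delta> * f y) / (\<alpha> * y + \<beta> * f y)" and "y \<in> - {0}"
    then obtain x where "x \<noteq> 0" "P x y"
      using to_x by auto
    then show "z \<in> (\<lambda>x. \<sigma> (g x / x)) ` (- {0})"
      using z slope \<open>y \<in> - {0}\<close> by auto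
  next
    fix z x assume z: "z = \<sigma> (g x / x)" and "x \<in> - {0}"
    then obtain y where y: "y \<noteq> 0" "P x y"
      using to_y by auto
    with z slope[OF y(2)] \<open>x \<in> - {0}\<close>
    have "z = (\<gamma> * y + \<delta> * f y) / (\<alpha> * y + \<beta> * f y)"
      by simp
    with y(1) show "z \<in> (\<lambda>y. (\<gamma> * y + \<delta> * f y) / (\<alpha> * y + \<beta> * f y)) ` (- {0})"
      by blast
  qed
  with \<sigma> det nz show ?thesis
    unfolding slopes_def image_image by blast
qed

section \<open>The trinomial\<close>

lemma permanent_2:
  fixes c :: "'b \<Rightarrow> 'b \<Rightarrow> 'a::comm_ring_1"
  assumes "i \<noteq> j"
  shows "(\<Sum>p | p permutes {i, j}. \<Prod>e\<in>{i, j}. c e (p e)) = c i i * c j j + c i j * c j i"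
  using assms
  by (simp add: sum_over_permutations_insert permutes_sing transpose_def)

lemma permanent_3_zero_diagonal:
  fixes c :: "nat \<Rightarrow> nat \<Rightarrow> 'a::comm_ring_1"
  assumes "\<And>i. c i i = 0"
  shows "(\<Sum>p | p permutes {0, 1, 2}. \<Prod>e\<in>{0, 1, 2}. c e (p e)) =
    c 0 1 * c 1 2 * c 2 0 + c 0 2 * c 1 0 * c 2 1"
  using assms
  by (simp add: sum_over_permutations_insert permutes_sing transpose_def algebra_simps)

text \<open>Entries with indices of equal parity vanish, so only permutations exchanging even and
  odd indices contribute, and the permanent is the product of those of the two remaining 2 by 2
  blocks.\<close>

lemma permanent_4_bipartite:
  fixes c :: "nat \<Rightarrow> nat \<Rightarrow> 'a::comm_ring_1"
  assumes "c 0 0 = 0" "c 0 2 = 0" "c 2 0 = 0" "c 2 2 = 0"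
    "c 1 1 = 0" "c 1 3 = 0" "c 3 1 = 0" "c 3 3 = 0"
  shows "(\<Sum>p | p permutes {0, 1, 2, 3}. \<Prod>e\<in>{0, 1, 2, 3}. c e (p e)) =
    (c 0 1 * c 2 3 + c 0 3 * c 2 1) * (c 1 0 * c 3 2 + c 1 2 * c 3 0)"
proof -
  have fin: "finite {3::nat}" "2 \<notin> {3::nat}" "finite {2::nat, 3}" "1 \<notin> {2::nat, 3}"
    "finite {1::nat, 2, 3}" "0 \<notin> {1::nat, 2, 3}"
    by auto
  show ?thesis
    unfolding sum_over_permutations_insert[OF fin(5,6)] sum_over_permutations_insert[OF fin(3,4)]
      sum_over_permutations_insert[OF fin(1,2)] permutes_sing
    using assms by (simp add: transpose_def) (simp add: algebra_simps)
qed

text \<open>In the application \<open>x\<close>, \<open>x'\<close>, \<open>x''\<close> are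
  conjugates of \<open>a 1\<close>, the \<open>y\<close>s conjugates of \<open>a 5\<close>, and
  \<open>z\<close>, \<open>z'\<close> conjugates of \<open>a 3\<close>. With \<open>?A\<close> and
  \<open>?D\<close> as in the proof, \<open>?A * z' + z * ?D = 1 + b ^ 3\<close> and
  \<open>?A * ?D = b ^ 3\<close>; multiplying the first by \<open>?A * z\<close> gives a quadratic
  equation for \<open>?A\<close> with roots \<open>z\<close> and \<open>b ^ 3 * z\<close>.\<close>

lemma quadruple_relation_factor:
  fixes b :: "'a::field"
  assumes "x * y = b" "x' * y' = b" "x'' * y'' = b" "z * z' = 1"
    and "(x * x'' + z * y') * (y * y'' + x' * z') = (1 + b) * (b * b + 1)"
  shows "(x * x' * x'' - z) * (x * x' * x'' - b ^ 3 * z) = 0"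
proof -
  let ?A = "x * x' * x''" and ?D = "y * y' * y''"
  have "(x * x'' + z * y') * (y * y'' + x' * z') =
      (x * y) * (x'' * y'') + ?A * z' + z * ?D + (z * z') * (x' * y')"
    by (simp add: algebra_simps)
  then have sum: "?A * z' + z * ?D = 1 + b ^ 3"
    unfolding assms by (simp add: algebra_simps power3_eq_cube)
  have "?A * ?D = (x * y) * (x' * y') * (x'' * y'')"
    by (simp only: mult_ac)
  then have AD: "?A * ?D = b ^ 3"
    unfolding assms by (simp add: power3_eq_cube mult_ac)
  have "?A * z * (1 + b ^ 3) = ?A * ?A * (z * z') + z * z * (?A * ?D)"
    unfolding sum[symmetric] by (simp add: algebra_simps)
  then show ?thesis
    unfolding AD assms(4) by (simp add: algebra_simps)
qed

lemma coprime_6_mod_6: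
  fixes s :: nat
  assumes "coprime s 6"
  shows "s mod 6 = 1 \<or> s mod 6 = 5"
proof -
  have "\<not> 2 dvd s" "\<not> 3 dvd s"
    using coprime_common_divisor[OF assms, of 2] coprime_common_divisor[OF assms, of 3] by auto
  then show ?thesis
    by presburger
qed

section \<open>Coefficient conditions from the slopes of the trinomial\<close>

definition trinomial :: "nat \<Rightarrow> 'a::field \<Rightarrow> 'a \<Rightarrow> 'a" where
  "trinomial q b x = x ^ q + x ^ (q ^ 3) + b * x ^ (q ^ 5)"

text \<open>The bound on \<open>q\<close> admits exponent sets \<open>E\<close> with up to four
  elements, which must have fewer than \<open>q\<close>.\<close>

locale sextic_ext = finite_field_ext T q 6 for T :: "'a::{field,finite} itself" and q +
  assumes q_ge_5: "q \<ge> 5"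
begin

definition trinomial_coeff :: "'a \<Rightarrow> nat \<Rightarrow> 'a" where
  "trinomial_coeff b i = (if i = 1 \<or> i = 3 then 1 else if i = 5 then b else 0)"

lemma sum_lessThan_6: "(\<Sum>i<6::nat. f i) = f 0 + f 1 + f 2 + f 3 + f 4 + (f 5 :: 'a)"
  by (simp add: eval_nat_numeral add_ac)

lemma trinomial_eq_qpoly: "trinomial q b = qpoly (trinomial_coeff b)"
  by (simp add: fun_eq_iff trinomial_def qpoly_def sum_lessThan_6 trinomial_coeff_def)

lemma coeff_sum_singleton: "coeff_sum a {0} = a 0"
  by (simp add: coeff_sum_def permutes_sing)

text \<open>The diagonal entries are powers of \<open>a 0\<close>, so only the transposition
  survives.\<close>

lemma coeff_sum_pair:
  assumes "a 0 = 0" and k: "0 < k" "k < 6"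
  shows "coeff_sum a {0, k} = a k * a (6 - k) ^ (q ^ k)"
  unfolding coeff_sum_def
  by (subst permanent_2[of 0 k "\<lambda>e j. a ((j + 6 - e) mod 6) ^ (q ^ e)"]) (use assms in \<open>simp_all add: power_0_left\<close>)

lemma coeff_sum_triple:
  assumes "a 0 = 0"
  shows "coeff_sum a {0, 1, 2} = a 1 * a 1 ^ q * a 4 ^ (q ^ 2) + a 2 * a 5 ^ q * a 5 ^ (q ^ 2)"
  unfolding coeff_sum_def
  by (subst permanent_3_zero_diagonal[of "\<lambda>e j. a ((j + 6 - e) mod 6) ^ (q ^ e)"]) (use assms in \<open>simp_all add: power_0_left\<close>)

lemma coeff_sum_quadruple:
  assumes "a 0 = 0" "a 2 = 0" "a 4 = 0"
  shows "coeff_sum a {0, 1, 2, 3} =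
    (a 1 * a 1 ^ (q ^ 2) + a 3 * a 5 ^ (q ^ 2)) * (a 5 ^ q * a 5 ^ (q ^ 3) + a 1 ^ q * a 3 ^ (q ^ 3))"
  unfolding coeff_sum_def
  by (subst permanent_4_bipartite[of "\<lambda>e j. a ((j + 6 - e) mod 6) ^ (q ^ e)"]) (use assms in \<open>simp_all add: power_0_left\<close>)

text \<open>Singletons, pairs, the triple and the quadruple are used in turn. The quadruple shows
  that the product of the first three conjugates of \<open>a 1\<close> is \<open>a 3\<close> times a
  nonzero element fixed by the \<open>q\<close>-th power; comparing with the \<open>q\<close>-th
  power of this relation yields the last claim.\<close>

lemma trinomial_slopes_imp_coeffs:
  assumes slopes: "slopes (qpoly a) = slopes (trinomial q b)"
    and b: "b ^ q = b" "b \<noteq> 0"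
  shows "a 0 = 0" "a 2 = 0" "a 4 = 0" "a 1 * a 5 ^ q = b" "a 3 * a 3 ^ (q ^ 3) = 1"
    "a 3 ^ q * a 1 = a 1 ^ (q ^ 3) * a 3"
proof -
  let ?c = "trinomial_coeff b"
  have eq: "coeff_sum a E = coeff_sum ?c E" if "E \<subseteq> {..<6}" "card E < 5" for E
    using slopes_eq_imp_coeff_sum_eq[OF slopes[unfolded trinomial_eq_qpoly] that(1)] that(2) q_ge_5
    by simp
  have c: "?c 0 = 0" "?c 1 = 1" "?c 2 = 0" "?c 3 = 1" "?c 4 = 0" "?c 5 = b"
    by (simp_all add: trinomial_coeff_def)
  have bq: "b ^ (q ^ i) = b" for i
    by (induction i) (simp_all add: power_mult b(1))
  show a0: "a 0 = 0"
    using eq[of "{0}"] c(1) unfolding coeff_sum_singleton by simp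
  have pair: "a k * a (6 - k) ^ (q ^ k) = ?c k * ?c (6 - k) ^ (q ^ k)" if "0 < k" "k < 6" for k
    using eq[of "{0, k}"] that a0 c(1) by (simp add: coeff_sum_pair)
  show a1: "a 1 * a 5 ^ q = b"
    using pair[of 1] c(2,6) b(1) by simp
  then have nz: "a 1 \<noteq> 0" "a 5 \<noteq> 0"
    using b(2) q_ge_5 by auto
  show a3: "a 3 * a 3 ^ (q ^ 3) = 1"
    using pair[of 3] c(4) by simp
  \<comment> \<open>The pair only gives a vanishing product; in the triple the other coefficient
    then stands alone, multiplied by nonzero factors.\<close>
  have a24: "a 2 = 0 \<or> a 4 = 0"
    using pair[of 2] c(3) by auto
  have "a 1 * a 1 ^ q * a 4 ^ (q ^ 2) + a 2 * a 5 ^ q * a 5 ^ (q ^ 2) = 0"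
    using eq[of "{0, 1, 2}"] c q_ge_5 unfolding coeff_sum_triple[of a, OF a0] coeff_sum_triple[of ?c, OF c(1)]
    by simp
  with a24 nz show a2: "a 2 = 0" and a4: "a 4 = 0"
    by (auto simp: power_0_left)
  have quadruple: "(a 1 * a 1 ^ (q ^ 2) + a 3 * a 5 ^ (q ^ 2)) *
      (a 5 ^ q * a 5 ^ (q ^ 3) + a 1 ^ q * a 3 ^ (q ^ 3)) = (1 + b) * (b * b + 1)"
    using eq[of "{0, 1, 2, 3}"]
    unfolding coeff_sum_quadruple[of a, OF a0 a2 a4] coeff_sum_quadruple[of ?c, OF c(1,3,5)] c bq b(1)
    by simp
  have pow_Suc: "(x ^ (q ^ i)) ^ q = x ^ (q ^ Suc i)" for x :: 'a and i
    by (simp add: mult.commute flip: power_mult)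
  have a1': "a 1 ^ q * a 5 ^ (q ^ 2) = b"
    using arg_cong[OF a1, of "\<lambda>x. x ^ q"] pow_Suc[of "a 5" 1] b(1)
    by (simp add: power_mult_distrib numeral_2_eq_2)
  have a1'': "a 1 ^ (q ^ 2) * a 5 ^ (q ^ 3) = b"
    using arg_cong[OF a1', of "\<lambda>x. x ^ q"] pow_Suc[of "a 1" 1] pow_Suc[of "a 5" 2] b(1)
    by (simp add: power_mult_distrib numeral_2_eq_2 numeral_3_eq_3)
  define A where "A = a 1 * a 1 ^ q * a 1 ^ (q ^ 2)"
  have "(A - a 3) * (A - b ^ 3 * a 3) = 0"
    unfolding A_def by (rule quadruple_relation_factor[OF a1 a1' a1'' a3 quadruple])
  moreover have "(b ^ 3) ^ q = b ^ 3"
    by (metis b(1) mult.commute power_mult)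
  \<comment> \<open>\<open>k\<close> is \<open>1\<close> or \<open>b ^ 3\<close>, whichever factor
    vanishes.\<close>
  ultimately obtain k where k: "A = k * a 3" "k ^ q = k" "k \<noteq> 0"
    using b(2) by (metis eq_iff_diff_eq_0 mult_1 mult_eq_0_iff power_not_zero power_one zero_neq_one)
  have "A ^ q = k * a 3 ^ q"
    using k by (simp add: power_mult_distrib)
  moreover have "A ^ q = a 1 ^ q * a 1 ^ (q ^ 2) * a 1 ^ (q ^ 3)"
    using pow_Suc[of "a 1" 1] pow_Suc[of "a 1" 2]
    by (simp add: A_def power_mult_distrib numeral_2_eq_2 numeral_3_eq_3)
  \<comment> \<open>Frobenius shifts the three conjugates in \<open>A\<close> by one, so
    \<open>a 1 * A ^ q = A * a 1 ^ (q ^ 3)\<close>.\<close>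
  ultimately have "k * (a 3 ^ q * a 1) = A * a 1 ^ (q ^ 3)"
    by (simp add: A_def)
  then have "k * (a 3 ^ q * a 1) = k * (a 1 ^ (q ^ 3) * a 3)"
    unfolding k(1) by (simp add: mult_ac)
  with k(3) show "a 3 ^ q * a 1 = a 1 ^ (q ^ 3) * a 3"
    by simp
qed

section \<open>From an equivalence to coefficient equations\<close>

lemma automorphism_slopes_trinomial:
  assumes "field_automorphism \<sigma>"
  shows "\<sigma> ` slopes (trinomial q b) = slopes (trinomial q (\<sigma> b :: 'a))"
proof -
  note \<sigma> = field_automorphismD[OF assms]
  have "\<sigma> ` slopes (trinomial q b) = (\<lambda>x. trinomial q (\<sigma> b) x / x) ` \<sigma> ` (- {0})"
    \<comment> \<open>\<open>\<sigma>\<close> commutes with powers and fixes the unit coefficients,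
      so only \<open>b\<close> changes.\<close>
    by (simp add: slopes_def image_image trinomial_def \<sigma>(4,5,8,9))
  also have "\<sigma> ` (- {0}) = - {0}"
    using \<sigma>(1,2,6) by (simp add: bij_image_Compl_eq bij_def)
  finally show ?thesis
    by (simp add: slopes_def)
qed

definition pencil :: "'a \<Rightarrow> 'a \<Rightarrow> (nat \<Rightarrow> 'a) \<Rightarrow> nat \<Rightarrow> 'a" where
  "pencil k l w i = (if i = 0 then k else 0) + l * w i"

lemma qpoly_pencil: "qpoly (pencil k l w) x = k * x + l * qpoly w x"
proof -
  have "qpoly (\<lambda>i. if i = 0 then k else 0) x = k * x"
    by (simp add: qpoly_def sum_lessThan_6)
  then show ?thesis
    unfolding pencil_def qpoly_coeff_add qpoly_smult by simp
qed

text \<open>With \<open>h\<close> and \<open>r\<close> the denominator and numerator of the slope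
  map, \<open>qpoly h\<close> has a linearized inverse, so \<open>a\<close> can be chosen with
  \<open>qpoly a\<close> equal to \<open>qpoly r\<close> after that inverse. It has the slopes of
  the trinomial for \<open>c = \<sigma> b\<close>, and the equations compare coefficients in
  \<open>qpoly a \<circ> qpoly h = qpoly r\<close>.\<close>

lemma equivalent_imp_coeff_equations:
  assumes equiv: "PGammaL_equivalent (linear_set (graph_of (trinomial q b))) (linear_set (graph_of (qpoly w)))"
    and b: "b ^ q = b" "b ^ 2 + b = 1"
  obtains a :: "nat \<Rightarrow> 'a" and c \<alpha> \<beta> \<gamma> \<delta> where
    "\<alpha> * \<delta> - \<beta> * \<gamma> \<noteq> 0" "a 1 \<noteq> 0" "a 3 \<noteq> 0" "a 5 \<noteq> 0"
    "c \<noteq> 1" "a 1 * a 5 ^ q = c" "a 3 * a 3 ^ (q ^ 3) = 1" "a 3 ^ q * a 1 = a 1 ^ (q ^ 3) * a 3"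
    "\<And>m. m < 6 \<Longrightarrow> a 1 * pencil \<alpha> \<beta> w ((m + 5) mod 6) ^ q +
      a 3 * pencil \<alpha> \<beta> w ((m + 3) mod 6) ^ (q ^ 3) +
      a 5 * pencil \<alpha> \<beta> w ((m + 1) mod 6) ^ (q ^ 5) = pencil \<gamma> \<delta> w m"
proof -
  have qpoly_0: "qpoly v 0 = 0" for v
    by (simp add: qpoly_def power_0_left)
  have "trinomial q b 0 = 0"
    by (simp add: trinomial_def power_0_left)
  from PGammaL_equivalent_graphs[OF equiv qpoly_0 this]
  obtain \<sigma> \<alpha> \<beta> \<gamma> \<delta> where \<sigma>: "field_automorphism \<sigma>" and det: "\<alpha> * \<delta> - \<beta> * \<gamma> \<noteq> 0"
    and nz: "\<And>y. y \<noteq> 0 \<Longrightarrow> \<alpha> * y + \<beta> * qpoly w y \<noteq> 0"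
    and image: "(\<lambda>y. (\<gamma> * y + \<delta> * qpoly w y) / (\<alpha> * y + \<beta> * qpoly w y)) ` (- {0}) =
      \<sigma> ` slopes (trinomial q b)"
    by blast
  define c where "c = \<sigma> b"
  note \<sigma>_props = field_automorphismD[OF \<sigma>]
  have c: "c ^ q = c" "c ^ 2 + c = 1"
    using b by (metis c_def \<sigma>_props(9), metis c_def \<sigma>_props(3,4,9))
  \<comment> \<open>The values \<open>0\<close> and \<open>1\<close> would give \<open>0 = 1\<close>
    and \<open>1 + 1 = 1\<close>.\<close>
  have c01: "c \<noteq> 0" "c \<noteq> 1"
    using c(2) by (auto, metis add_cancel_left_left one_add_one zero_neq_one)
  define h r where "h = pencil \<alpha> \<beta> w" and "r = pencil \<gamma> \<delta> w"
  have h: "qpoly h x = \<alpha> * x + \<beta> * qpoly w x" and r: "qpoly r x = \<gamma> * x + \<delta> * qpoly w x" for x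
    unfolding h_def r_def by (rule qpoly_pencil)+
  have h_eq_0: "qpoly h x = 0 \<longleftrightarrow> x = 0" for x
    using nz[of x] by (auto simp: h qpoly_0)
  have "qpoly h (- y) = - qpoly h y" for y
    using qpoly_add[of h y "- y"] by (simp add: qpoly_0 eq_neg_iff_add_eq_0 add.commute)
  then have "qpoly h (x - y) = qpoly h x - qpoly h y" for x y
    using qpoly_add[of h x "- y"] by simp
  then have "inj (qpoly h)"
    using h_eq_0 by (intro injI) (metis right_minus_eq)
  then obtain k where k: "\<And>x. qpoly h (qpoly k x) = x"
    using inj_qpoly_inverse by blast
  with \<open>inj (qpoly h)\<close> have k': "qpoly k (qpoly h x) = x" for x
    by (metis injD)
  obtain a where a: "\<And>x. qpoly a x = qpoly r (qpoly k x)"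
    using that[OF qpoly_comp[symmetric]] .
  have ah: "qpoly a (qpoly h x) = qpoly r x" for x
    by (simp only: a k')
  \<comment> \<open>\<open>qpoly h\<close> permutes the nonzero elements, which allows this
    substitution.\<close>
  have "slopes (qpoly a) = (\<lambda>y. qpoly a (qpoly h y) / qpoly h y) ` (- {0})"
  proof -
    have "qpoly h ` (- {0}) = - qpoly h ` {0}"
      using \<open>inj (qpoly h)\<close> k by (intro bij_image_Compl_eq) (metis bijI surjI)
    then have "- {0} = qpoly h ` (- {0})"
      by (simp add: qpoly_0)
    then have "slopes (qpoly a) = (\<lambda>x. qpoly a x / x) ` qpoly h ` (- {0})"
      unfolding slopes_def by (rule arg_cong)
    then show ?thesis
      by (simp only: image_image)
  qed
  then have "slopes (qpoly a) = slopes (trinomial q c)"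
    unfolding ah unfolding h r image automorphism_slopes_trinomial[OF \<sigma>] c_def .
  note coeffs = trinomial_slopes_imp_coeffs[OF this c(1) c01(1)]
  have eqs: "a 1 * h ((m + 5) mod 6) ^ q + a 3 * h ((m + 3) mod 6) ^ (q ^ 3) + a 5 * h ((m + 1) mod 6) ^ (q ^ 5) = r m"
    if "m < 6" for m
  proof -
    have "qpoly (\<lambda>m. \<Sum>i<6. a i * h ((m + 6 - i) mod 6) ^ (q ^ i)) x = qpoly r x" for x
      unfolding qpoly_comp[symmetric] by (rule ah)
    from qpoly_coeff_unique[OF this that]
    have "(\<Sum>i<6. a i * h ((m + 6 - i) mod 6) ^ (q ^ i)) = r m" .
    then show ?thesis
      unfolding sum_lessThan_6 by (simp add: coeffs(1-3) add.commute)
  qed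
  have "a 1 \<noteq> 0" "a 3 \<noteq> 0" "a 5 \<noteq> 0"
    using coeffs(4,5) c01(1) by (auto simp: power_0_left)
  from that[OF det this c01(2) coeffs(4-6) eqs[unfolded h_def r_def]] show ?thesis .
qed

section \<open>Exclusion of the three families\<close>

lemma not_equivalent_L1:
  assumes b: "b ^ q = b" "b ^ 2 + b = 1" and "coprime s 6"
  shows "\<not> PGammaL_equivalent (linear_set (graph_of (trinomial q (b :: 'a)))) (L1 q s)"
proof
  assume equiv: "PGammaL_equivalent (linear_set (graph_of (trinomial q b))) (L1 q s)"
  define w :: "nat \<Rightarrow> 'a" where "w = (\<lambda>i. if i = s mod 6 then 1 else 0)"
  have "L1 q s = linear_set (graph_of (qpoly w))"
    unfolding L1_def w_def qpoly_monom ..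
  with equiv have "PGammaL_equivalent (linear_set (graph_of (trinomial q b))) (linear_set (graph_of (qpoly w)))"
    by simp
  then obtain a :: "nat \<Rightarrow> 'a" and c \<alpha> \<beta> \<gamma> \<delta> where det: "\<alpha> * \<delta> - \<beta> * \<gamma> \<noteq> 0"
    and nz: "a 1 \<noteq> 0" "a 3 \<noteq> 0" "a 5 \<noteq> 0"
    and coeffs: "c \<noteq> 1" "a 1 * a 5 ^ q = c" "a 3 * a 3 ^ (q ^ 3) = 1" "a 3 ^ q * a 1 = a 1 ^ (q ^ 3) * a 3"
    and eqs: "\<And>m. m < 6 \<Longrightarrow> a 1 * pencil \<alpha> \<beta> w ((m + 5) mod 6) ^ q +
      a 3 * pencil \<alpha> \<beta> w ((m + 3) mod 6) ^ (q ^ 3) +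
      a 5 * pencil \<alpha> \<beta> w ((m + 1) mod 6) ^ (q ^ 5) = pencil \<gamma> \<delta> w m"
    by (rule equivalent_imp_coeff_equations[OF _ b]) (rule that)
  \<comment> \<open>Indices 3 and 2 lie outside the support of \<open>w\<close>, so both right sides
    vanish; the left sides retain only a term in \<open>\<alpha>\<close> and only one in
    \<open>\<beta>\<close>, respectively.\<close>
  from coprime_6_mod_6[OF \<open>coprime s 6\<close>]
  have "\<alpha> = 0" "\<beta> = 0"
    using eqs[of 3] eqs[of 2] nz by (auto simp: w_def pencil_def power_0_left)
  with det show False
    by simp
qed

text \<open>Here only \<open>\<alpha>\<close> is forced to vanish. The equations of indices 2 and 4
  form, after Frobenius powers, a homogeneous linear system with a nonzero solution; its vanishing
  determinant and the relations among the \<open>a i\<close> give \<open>c = 1\<close>.\<close>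

lemma not_equivalent_L2:
  assumes b: "b ^ q = b" "b ^ 2 + b = 1" and t: "coprime t 6" "t < 6" and "\<rho> \<noteq> 0"
  shows "\<not> PGammaL_equivalent (linear_set (graph_of (trinomial q (b :: 'a)))) (L2 q t \<rho>)"
proof
  assume equiv: "PGammaL_equivalent (linear_set (graph_of (trinomial q b))) (L2 q t \<rho>)"
  define w :: "nat \<Rightarrow> 'a"
    where "w = (\<lambda>i. \<rho> * (if i = t mod 6 then 1 else 0) + (if i = (6 - t) mod 6 then 1 else 0))"
  have "qpoly w x = \<rho> * x ^ (q ^ t) + x ^ (q ^ (6 - t))" for x
    unfolding w_def qpoly_coeff_add qpoly_smult qpoly_monom ..
  then have "L2 q t \<rho> = linear_set (graph_of (qpoly w))"
    unfolding L2_def by presburger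
  with equiv have "PGammaL_equivalent (linear_set (graph_of (trinomial q b))) (linear_set (graph_of (qpoly w)))"
    by simp
  then obtain a :: "nat \<Rightarrow> 'a" and c \<alpha> \<beta> \<gamma> \<delta> where det: "\<alpha> * \<delta> - \<beta> * \<gamma> \<noteq> 0"
    and nz: "a 1 \<noteq> 0" "a 3 \<noteq> 0" "a 5 \<noteq> 0"
    and coeffs: "c \<noteq> 1" "a 1 * a 5 ^ q = c" "a 3 * a 3 ^ (q ^ 3) = 1" "a 3 ^ q * a 1 = a 1 ^ (q ^ 3) * a 3"
    and eqs: "\<And>m. m < 6 \<Longrightarrow> a 1 * pencil \<alpha> \<beta> w ((m + 5) mod 6) ^ q +
      a 3 * pencil \<alpha> \<beta> w ((m + 3) mod 6) ^ (q ^ 3) +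
      a 5 * pencil \<alpha> \<beta> w ((m + 1) mod 6) ^ (q ^ 5) = pencil \<gamma> \<delta> w m"
    by (rule equivalent_imp_coeff_equations[OF _ b]) (rule that)
  have "t = 1 \<or> t = 5"
    using coprime_6_mod_6[OF t(1)] t(2) by simp
  \<comment> \<open>For \<open>t = 5\<close> the two coefficients merely swap places.\<close>
  then have w0: "w 0 = 0" "w 2 = 0" "w 3 = 0" "w 4 = 0" and w1: "w 1 \<noteq> 0" "w 5 \<noteq> 0"
    using \<open>\<rho> \<noteq> 0\<close> by (auto simp: w_def)
  have "\<alpha> = 0"
    using eqs[of 3] nz w0 by (simp add: pencil_def power_0_left)
  with det have "\<beta> \<noteq> 0"
    by auto
  define u v where "u = \<beta> * w 1" and "v = \<beta> * w 5"
  have uv: "u \<noteq> 0" "v \<noteq> 0"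
    using w1 \<open>\<beta> \<noteq> 0\<close> by (auto simp: u_def v_def)
  have "a 1 * u ^ q + a 3 * v ^ (q ^ 3) = 0"
    using eqs[of 2] w0 by (simp add: u_def v_def pencil_def power_0_left)
  \<comment> \<open>The powers \<open>q ^ 3\<close> here and \<open>q\<close> below make both
    equations linear in \<open>u ^ (q ^ 4)\<close> and \<open>v\<close>.\<close>
  from arg_cong[OF this, of "\<lambda>x. x ^ (q ^ 3)"]
  have 1: "a 1 ^ (q ^ 3) * u ^ (q ^ 4) + a 3 ^ (q ^ 3) * v = 0"
    using power_q_power_q[of u 1 3] power_q_power_q[of v 3 3] power_q_mod[of v 6]
    by (simp add: power_q_add power_mult_distrib)
  have "a 3 * u ^ (q ^ 3) + a 5 * v ^ (q ^ 5) = 0"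
    using eqs[of 4] w0 by (simp add: u_def v_def pencil_def power_0_left)
  from arg_cong[OF this, of "\<lambda>x. x ^ (q ^ 1)"]
  have 2: "a 3 ^ q * u ^ (q ^ 4) + a 5 ^ q * v = 0"
    using power_q_power_q[of u 3 1] power_q_power_q[of v 5 1] power_q_mod[of v 6]
    unfolding power_q_add by (simp add: power_mult_distrib)
  have "a 1 ^ (q ^ 3) * a 5 ^ q = a 3 ^ q * a 3 ^ (q ^ 3)"
  proof -
    have "u ^ (q ^ 4) * v * (a 1 ^ (q ^ 3) * a 5 ^ q) = u ^ (q ^ 4) * v * (a 3 ^ q * a 3 ^ (q ^ 3))"
    proof -
      have "a 1 ^ (q ^ 3) * u ^ (q ^ 4) = - (a 3 ^ (q ^ 3) * v)" "a 5 ^ q * v = - (a 3 ^ q * u ^ (q ^ 4))"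
        using 1 2 by (simp_all add: eq_neg_iff_add_eq_0 add.commute)
      then have "(a 1 ^ (q ^ 3) * u ^ (q ^ 4)) * (a 5 ^ q * v) = (a 3 ^ (q ^ 3) * v) * (a 3 ^ q * u ^ (q ^ 4))"
        by simp
      then show ?thesis
        by (simp only: mult_ac)
    qed
    with uv show ?thesis
      by simp
  qed
  then have "a 1 ^ (q ^ 3) * a 3 * (a 1 * a 5 ^ q) = a 3 ^ q * a 1 * (a 3 * a 3 ^ (q ^ 3))"
    by (simp add: mult_ac)
  then have "a 1 ^ (q ^ 3) * a 3 * c = a 1 ^ (q ^ 3) * a 3 * 1"
    unfolding coeffs(2-4) .
  with nz coeffs(1) show False
    by simp
qed

text \<open>The support of \<open>w\<close> is \<open>{1, 4}\<close> or \<open>{2, 5}\<close>. Index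
  2 or 4, respectively, is outside it, and its equation has a single surviving term, in
  \<open>\<beta>\<close>. Once \<open>\<beta> = 0\<close>, index 3 leaves \<open>\<alpha>\<close>
  alone.\<close>

lemma not_equivalent_L3:
  assumes b: "b ^ q = b" "b ^ 2 + b = 1" and h: "coprime h 3" and "\<xi> \<noteq> 0"
  shows "\<not> PGammaL_equivalent (linear_set (graph_of (trinomial q (b :: 'a)))) (L3 q h \<xi>)"
proof
  assume equiv: "PGammaL_equivalent (linear_set (graph_of (trinomial q b))) (L3 q h \<xi>)"
  define w :: "nat \<Rightarrow> 'a"
    where "w = (\<lambda>i. \<xi> * (if i = h mod 6 then 1 else 0) + (if i = (h + 3) mod 6 then 1 else 0))"
  have "qpoly w x = \<xi> * x ^ (q ^ h) + x ^ (q ^ (h + 3))" for x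
    unfolding w_def qpoly_coeff_add qpoly_smult qpoly_monom ..
  then have "L3 q h \<xi> = linear_set (graph_of (qpoly w))"
    unfolding L3_def by presburger
  with equiv have "PGammaL_equivalent (linear_set (graph_of (trinomial q b))) (linear_set (graph_of (qpoly w)))"
    by simp
  then obtain a :: "nat \<Rightarrow> 'a" and c \<alpha> \<beta> \<gamma> \<delta> where det: "\<alpha> * \<delta> - \<beta> * \<gamma> \<noteq> 0"
    and nz: "a 1 \<noteq> 0" "a 3 \<noteq> 0" "a 5 \<noteq> 0"
    and coeffs: "c \<noteq> 1" "a 1 * a 5 ^ q = c" "a 3 * a 3 ^ (q ^ 3) = 1" "a 3 ^ q * a 1 = a 1 ^ (q ^ 3) * a 3"
    and eqs: "\<And>m. m < 6 \<Longrightarrow> a 1 * pencil \<alpha> \<beta> w ((m + 5) mod 6) ^ q +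
      a 3 * pencil \<alpha> \<beta> w ((m + 3) mod 6) ^ (q ^ 3) +
      a 5 * pencil \<alpha> \<beta> w ((m + 1) mod 6) ^ (q ^ 5) = pencil \<gamma> \<delta> w m"
    by (rule equivalent_imp_coeff_equations[OF _ b]) (rule that)
  have "\<not> 3 dvd h"
    using coprime_common_divisor[OF h, of 3] by auto
  then have "h mod 6 = 1 \<and> (h + 3) mod 6 = 4 \<or> h mod 6 = 4 \<and> (h + 3) mod 6 = 1 \<or>
      h mod 6 = 2 \<and> (h + 3) mod 6 = 5 \<or> h mod 6 = 5 \<and> (h + 3) mod 6 = 2"
    by presburger
  then consider
    (14) "w 1 \<noteq> 0" "w 0 = 0" "w 2 = 0" "w 3 = 0" "w 5 = 0" |
    (25) "w 5 \<noteq> 0" "w 0 = 0" "w 1 = 0" "w 3 = 0" "w 4 = 0"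
    using \<open>\<xi> \<noteq> 0\<close> by (auto simp: w_def)
  then have "\<beta> = 0 \<and> w 3 = 0"
  proof cases
    case 14
    then show ?thesis
      using eqs[of 2] nz by (simp add: pencil_def power_0_left)
  next
    case 25
    then show ?thesis
      using eqs[of 4] nz by (simp add: pencil_def power_0_left)
  qed
  moreover from this have "\<alpha> = 0"
    using eqs[of 3] nz by (simp add: pencil_def power_0_left)
  ultimately show False
    using det by simp
qed

end

theorem theorem5p4:
  fixes q :: nat and b :: "'a::{field,finite}" and g :: "'a \<Rightarrow> 'a"
  assumes "primepow q" and "odd q"
    and "[int q = 0] (mod 5) \<or> [int q = 1] (mod 5) \<or> [int q = -1] (mod 5)"
    and "CARD('a) = q ^ 6"
    and "b \<in> Fq q" and "b ^ 2 + b = 1"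
    and "\<And>x. g x = x ^ q + x ^ (q ^ 3) + b * x ^ (q ^ 5)"
  shows "(\<forall>s. coprime s 6 \<longrightarrow>
            \<not> PGammaL_equivalent (linear_set (graph_of g)) (L1 q s))
       \<and> (\<forall>t \<rho>. t < 6 \<and> coprime t 6 \<and> rel_norm q 6 \<rho> \<notin> {0, 1} \<longrightarrow>
            \<not> PGammaL_equivalent (linear_set (graph_of g)) (L2 q t \<rho>))
       \<and> (\<forall>h \<xi>. coprime h 3 \<and> rel_norm (q ^ 3) 2 \<xi> \<notin> {0, 1} \<and> maximum_scattered q (L3 q h \<xi>) \<longrightarrow>
            \<not> PGammaL_equivalent (linear_set (graph_of g)) (L3 q h \<xi>))"
proof -
  have "q > 1"
    using primepow_gt_Suc_0[OF assms(1)] by simp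
  \<comment> \<open>\<open>3\<close> is none of \<open>0\<close>, \<open>1\<close>,
    \<open>-1\<close> modulo 5; an odd \<open>q > 1\<close> is then at least 5.\<close>
  moreover have "q \<noteq> 3"
    using assms(3) by (auto simp: cong_def)
  ultimately have "q \<ge> 5"
    using assms(2) by presburger
  then interpret sextic_ext "TYPE('a)" q
    using assms(1,4) by unfold_locales
  have g: "g = trinomial q b"
    by (simp add: fun_eq_iff assms(7) trinomial_def)
  have b: "b ^ q = b" "b ^ 2 + b = 1"
    using assms(5,6) by (simp_all add: Fq_def)
  \<comment> \<open>The norm of \<open>0\<close> is \<open>0\<close>: the product is nonempty and
    its exponents are positive.\<close>
  have nz: "x \<noteq> 0" if "rel_norm q' m x \<notin> {0, 1}" "q' \<noteq> 0" "m \<noteq> 0" for x :: 'a and q' m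
    using that by (auto simp: rel_norm_def power_0_left)
  show ?thesis
    unfolding g
  proof (intro conjI allI impI; (elim conjE)?)
    fix s :: nat assume "coprime s 6"
    then show "\<not> PGammaL_equivalent (linear_set (graph_of (trinomial q b))) (L1 q s)"
      by (rule not_equivalent_L1[OF b])
  next
    fix t :: nat and \<rho> :: 'a assume "t < 6" "coprime t 6" "rel_norm q 6 \<rho> \<notin> {0, 1}"
    then show "\<not> PGammaL_equivalent (linear_set (graph_of (trinomial q b))) (L2 q t \<rho>)"
      using nz[of q 6 \<rho>] by (intro not_equivalent_L2[OF b]) auto
  next
    fix h :: nat and \<xi> :: 'a assume "coprime h 3" "rel_norm (q ^ 3) 2 \<xi> \<notin> {0, 1}"
    then show "\<not> PGammaL_equivalent (linear_set (graph_of (trinomial q b))) (L3 q h \<xi>)"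
      using nz[of "q ^ 3" 2 \<xi>] by (intro not_equivalent_L3[OF b]) auto
  qed
qed

end
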